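(* Let $k\ge 0$ be an integer. If $G$ is a directed graph of treewidth (at most) $k$, then $f(G)\leq \frac{k}{k+3}\,n(G)$.
   Context: Directed graphs are oriented graphs: finite, no loops, no multiple arcs and no pair of antiparallel arcs. $n(G)$ is the number of vertices and $f(G)$ is the minimum size of a set $F\subseteq V(G)$ such that $G-F$ contains no directed cycle. An undirected graph is a $k$-tree if it has a vertex ordering $\phi$ such that, for each vertex $v$, the set of neighbours of $v$ preceding it is a clique of size exactly $\min(k,\phi(v)-1)$. An undirected graph has treewidth $k$ (in the sense used here: at most $k$) if it is a subgraph of a $k$-tree; a directed graph has treewidth $k$ if its underlying undirected graph does. *)

theory Defs
  imports Complex_Main
begin

definition oriented_graph :: "'a set \<Rightarrow> ('a \<times> 'a) set \<Rightarrow> bool" where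
  "oriented_graph V A \<longleftrightarrow> finite V \<and> A \<subseteq> V \<times> V \<and> (\<forall>v. (v, v) \<notin> A)
     \<and> (\<forall>u v. (u, v) \<in> A \<longrightarrow> (v, u) \<notin> A)"

definition dfvs :: "'a set \<Rightarrow> ('a \<times> 'a) set \<Rightarrow> 'a set \<Rightarrow> bool" where
  "dfvs V A F \<longleftrightarrow> F \<subseteq> V \<and> acyclic (A \<inter> ((V - F) \<times> (V - F)))"

definition fvs_number :: "'a set \<Rightarrow> ('a \<times> 'a) set \<Rightarrow> nat" where
  "fvs_number V A = Min {card F | F. dfvs V A F}"

definition is_ktree :: "nat \<Rightarrow> 'b set \<Rightarrow> 'b set set \<Rightarrow> bool" where
  "is_ktree k W E \<longleftrightarrow> finite W \<and> E \<subseteq> {e. e \<subseteq> W \<and> card e = 2} \<and>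
     (\<exists>\<phi>. bij_betw \<phi> W {1..card W} \<and>
        (\<forall>v\<in>W. let P = {u\<in>W. {u, v} \<in> E \<and> \<phi> u < \<phi> v} in
            (\<forall>x\<in>P. \<forall>y\<in>P. x \<noteq> y \<longrightarrow> {x, y} \<in> E) \<and> card P = min k (\<phi> v - 1)))"

definition treewidth_le :: "nat \<Rightarrow> 'a set \<Rightarrow> ('a \<times> 'a) set \<Rightarrow> bool" where
  "treewidth_le k V A \<longleftrightarrow> (\<exists>(g :: 'a \<Rightarrow> nat) W E. inj_on g V \<and> g ` V \<subseteq> W \<and> is_ktree k W E \<and>
     (\<forall>(u, v)\<in>A. {g u, g v} \<in> E))"

end

theory Submission
  imports Defs
begin

text \<open>
  Orient all edges of the ambient \<open>k\<close>-tree. Since preceding neighbourhoods are cliques, a vertex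
  set induces an acyclic digraph as soon as it contains no cyclic triangle. For \<open>k \<le> 2\<close> a proper
  \<open>(k + 1)\<close>-colouring suffices. For \<open>k \<ge> 3\<close> one repeatedly deletes a set \<open>F\<close> and keeps a set \<open>H\<close>
  that meets no cyclic triangle outside \<open>F\<close>, with \<open>3 (|F| + |H|) \<le> (k + 3) |H|\<close>.

  Such a pair is found at the bottom of the elimination tree, where the parent of a vertex is its
  last preceding neighbour: the descendants \<open>T v\<close> of \<open>v\<close> see only the at most \<open>k\<close> preceding
  neighbours \<open>P v\<close> outside \<open>T v\<close>. Take \<open>v\<close> lowest with \<open>|T v| \<ge> 4\<close>. Among four vertices some
  three span no cyclic triangle, and deleting \<open>P v\<close> and the fourth costs one vertex too many; but a
  child \<open>c\<close> of \<open>v\<close> has \<open>v\<close> among its at most \<open>k\<close> preceding neighbours, so it misses some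
  \<open>y \<in> P v\<close>, and \<open>y\<close> need not be deleted. When \<open>v\<close> has several children, the same saving is made
  once or twice, using that a vertex closes a cyclic triangle with at most two of the three pairs
  of a triple.
\<close>

subsection \<open>Cyclic triangles in orientations\<close>

definition adj :: "('v \<Rightarrow> 'v \<Rightarrow> bool) \<Rightarrow> 'v \<Rightarrow> 'v \<Rightarrow> bool" where
  "adj A x y \<longleftrightarrow> A x y \<or> A y x"

definition cyc :: "('v \<Rightarrow> 'v \<Rightarrow> bool) \<Rightarrow> 'v \<Rightarrow> 'v \<Rightarrow> 'v \<Rightarrow> bool" where
  "cyc A x y z \<longleftrightarrow> A x y \<and> A y z \<and> A z x"

definition triangle_free :: "('v \<Rightarrow> 'v \<Rightarrow> bool) \<Rightarrow> 'v set \<Rightarrow> bool" where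
  "triangle_free A S \<longleftrightarrow> (\<forall>x\<in>S. \<forall>y\<in>S. \<forall>z\<in>S. \<not> cyc A x y z)"

definition pre :: "('v::linorder \<Rightarrow> 'v \<Rightarrow> bool) \<Rightarrow> 'v set \<Rightarrow> 'v \<Rightarrow> 'v set" where
  "pre A V v = {u \<in> V. u < v \<and> adj A u v}"

text \<open>\<open>F\<close> is deleted and \<open>H\<close> kept for good. Since \<open>x\<close>
  and \<open>y\<close> range over all of \<open>V - F\<close>, no later choice closes a cyclic
  triangle with \<open>H\<close>; the inequality is \<open>3n \<le> (k + 3)|S|\<close> for one
  round, so rounds add up.\<close>

definition reducible :: "('v \<Rightarrow> 'v \<Rightarrow> bool) \<Rightarrow> 'v set \<Rightarrow> nat \<Rightarrow> bool" where
  "reducible A V k \<longleftrightarrow> (\<exists>F H. F \<union> H \<subseteq> V \<and> F \<inter> H = {} \<and> H \<noteq> {} \<and>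
     3 * (card F + card H) \<le> (k + 3) * card H \<and>
     (\<forall>h\<in>H. \<forall>x\<in>V - F. \<forall>y\<in>V - F. \<not> cyc A h x y))"

lemma triangle_free_mono: "triangle_free A S \<Longrightarrow> R \<subseteq> S \<Longrightarrow> triangle_free A R"
  unfolding triangle_free_def by blast

text \<open>Used to spare a vertex: if \<open>|P| = k\<close>, some element of \<open>P\<close> lies
  outside \<open>Q\<close>; otherwise \<open>Y\<close> is empty.\<close>

lemma obtain_small_difference:
  assumes "finite P" "card P \<le> k" "card (P \<inter> Q) < k"
  obtains Y where "Y \<subseteq> P - Q" "card Y \<le> 1" "card (P - Y) < k"
proof (cases "card P < k")
  case True
  then show thesis using that[of "{}"] by simp
next
  case False
  then have eq: "card P = k" using assms by simp
  then have "P - Q \<noteq> {}" using assms(3) by (metis Diff_eq_empty_iff inf.absorb1 less_irrefl)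
  then obtain y where y: "y \<in> P - Q" by blast
  then have "card (P - {y}) < k" using assms(1) eq by (metis DiffD1 card_Diff1_less)
  then show thesis using that[of "{y}"] y by simp
qed

lemma card_3_cases:
  assumes "card T = 3"
  obtains a b c where "T = {a, b, c}" "a \<noteq> b" "b \<noteq> c" "a \<noteq> c"
  using assms by (auto simp: card_Suc_eq numeral_eq_Suc)

locale asym_orientation =
  fixes A :: "'v \<Rightarrow> 'v \<Rightarrow> bool"
  assumes asym: "A x y \<Longrightarrow> \<not> A y x"
begin

lemma irrefl: "\<not> A x x"
  using asym by blast

lemma cyc_distinct: "cyc A x y z \<Longrightarrow> x \<noteq> y \<and> y \<noteq> z \<and> x \<noteq> z"
  unfolding cyc_def using irrefl by blast

lemma cyc_adj: "cyc A x y z \<Longrightarrow> adj A x y \<and> adj A y x \<and> adj A y z \<and> adj A z x \<and> adj A x z"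
  unfolding cyc_def adj_def by blast

lemma triangle_free_card_le_2:
  assumes "finite S" "card S \<le> 2"
  shows "triangle_free A S"
  unfolding triangle_free_def
proof (intro ballI notI)
  fix x y z assume *: "x \<in> S" "y \<in> S" "z \<in> S" "cyc A x y z"
  then have "card {x, y, z} = 3" using cyc_distinct[OF *(4)] by simp
  moreover have "card {x, y, z} \<le> card S" using * assms(1) by (intro card_mono) auto
  ultimately show False using assms(2) by simp
qed

lemma triangle_free_3:
  "triangle_free A {a, b, c} \<longleftrightarrow> \<not> cyc A a b c \<and> \<not> cyc A a c b"
proof
  assume "triangle_free A {a, b, c}"
  then show "\<not> cyc A a b c \<and> \<not> cyc A a c b"
    unfolding triangle_free_def by blast
next
  assume *: "\<not> cyc A a b c \<and> \<not> cyc A a c b"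
  show "triangle_free A {a, b, c}"
    unfolding triangle_free_def
  proof (intro ballI notI)
    fix x y z assume h: "x \<in> {a, b, c}" "y \<in> {a, b, c}" "z \<in> {a, b, c}" "cyc A x y z"
    with cyc_distinct[OF h(4)] have "cyc A a b c \<or> cyc A a c b"
      unfolding cyc_def by auto
    then show False using * by blast
  qed
qed

text \<open>A vertex closing cyclic triangles with all three pairs of \<open>T\<close> would need any two
  elements of \<open>T\<close> to lie on opposite sides of it.\<close>

lemma pair_avoiding_triangle:
  assumes "card T = 3"
  obtains t where "t \<in> T" "triangle_free A (insert y (T - {t}))"
proof -
  obtain a b c where T: "T = {a, b, c}" "a \<noteq> b" "b \<noteq> c" "a \<noteq> c"
    using assms by (rule card_3_cases)
  have "triangle_free A {y, b, c} \<or> triangle_free A {y, a, c} \<or> triangle_free A {y, a, b}"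
    unfolding triangle_free_3 cyc_def using asym by blast
  moreover have "T - {a} = {b, c}" "T - {b} = {a, c}" "T - {c} = {a, b}" using T by auto
  ultimately show thesis using that[of a] that[of b] that[of c] T by auto
qed

lemma triple_avoiding_triangle:
  assumes "card T = 4"
  obtains t where "t \<in> T" "triangle_free A (T - {t})"
proof -
  obtain y T' where T: "T = insert y T'" "y \<notin> T'" "card T' = 3"
    using assms card_Suc_eq[of T 3] by auto
  obtain t where t: "t \<in> T'" "triangle_free A (insert y (T' - {t}))"
    using pair_avoiding_triangle[OF T(3)] .
  have "T - {t} = insert y (T' - {t})" using T t by auto
  then show thesis using that[of t] t T by simp
qed

text \<open>Trims a branch to \<open>|T| = 2|H| - 1\<close> while tolerating one spared vertex
  outside: a single vertex with \<open>Y\<close> is too small for a triangle, and a triple loses one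
  element by \<open>pair_avoiding_triangle\<close>.\<close>

lemma split_branch:
  assumes "card T = 1 \<or> card T = 3" "card Y \<le> 1" "finite Y"
  obtains H where "H \<subseteq> T" "triangle_free A (H \<union> Y)" "card H = 1 \<or> card H = 2"
    "card (T - H) + 1 = card H"
proof (cases "card T = 1")
  case True
  then have "finite T" using card.infinite by fastforce
  then have "card (T \<union> Y) \<le> 2" using card_Un_le[of T Y] assms True by simp
  then have "triangle_free A (T \<union> Y)"
    using triangle_free_card_le_2 \<open>finite T\<close> assms(3) by simp
  then show thesis using that[of T] True by simp
next
  case False
  then have 3: "card T = 3" using assms by simp
  then have fT: "finite T" using card.infinite by fastforce
  obtain y where y: "Y \<subseteq> {y}"
    using assms(2,3) by (metis card_le_Suc0_iff_eq One_nat_def empty_subsetI insertI1 subsetI singletonI)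
  obtain t where t: "t \<in> T" "triangle_free A (insert y (T - {t}))"
    using pair_avoiding_triangle[OF 3] .
  have "triangle_free A ((T - {t}) \<union> Y)"
    by (rule triangle_free_mono[OF t(2)]) (use y in blast)
  moreover have "card (T - {t}) = 2" using t 3 fT by simp
  moreover have "T - (T - {t}) = {t}" using t by blast
  ultimately show thesis using that[of "T - {t}"] by auto
qed

end

subsection \<open>The elimination tree\<close>

text \<open>The underlying graph is chordal and the order is a reversed perfect elimination order.
  Sizes are only bounded by \<open>k\<close>, so the structure passes to subsets.\<close>

locale elimination_order = asym_orientation A
  for A :: "'v::linorder \<Rightarrow> 'v \<Rightarrow> bool" +
  fixes V :: "'v set" and k :: nat
  assumes fin: "finite V"
    and pre_card: "v \<in> V \<Longrightarrow> card (pre A V v) \<le> k"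
    and pre_clique: "v \<in> V \<Longrightarrow> x \<in> pre A V v \<Longrightarrow> y \<in> pre A V v \<Longrightarrow> x \<noteq> y \<Longrightarrow> adj A x y"
begin

abbreviation P where "P \<equiv> pre A V"

definition parent :: "('v \<times> 'v) set" where
  "parent = {(p, w). w \<in> V \<and> P w \<noteq> {} \<and> p = Max (P w)}"

definition T :: "'v \<Rightarrow> 'v set" where
  "T v = {w. (v, w) \<in> parent\<^sup>*}"

lemma adj_sym: "adj A x y \<longleftrightarrow> adj A y x"
  unfolding adj_def by blast

lemma finP: "finite (P v)"
  unfolding pre_def using fin by simp

lemma P_sub: "P v \<subseteq> V"
  unfolding pre_def by blast

lemma P_less: "u \<in> P v \<Longrightarrow> u < v"
  unfolding pre_def by blast

lemma parentD: "(p, w) \<in> parent \<Longrightarrow> p \<in> P w \<and> w \<in> V \<and> p \<in> V \<and> p < w"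
  unfolding parent_def using Max_in[OF finP] P_sub P_less by blast

lemma parent_max: "(p, w) \<in> parent \<Longrightarrow> u \<in> P w \<Longrightarrow> u \<le> p"
  unfolding parent_def using Max_ge[OF finP] by blast

lemma parent_unique: "(p, w) \<in> parent \<Longrightarrow> (q, w) \<in> parent \<Longrightarrow> p = q"
  unfolding parent_def by blast

lemma parent_exists: "w \<in> V \<Longrightarrow> u \<in> P w \<Longrightarrow> \<exists>p. (p, w) \<in> parent"
  unfolding parent_def by blast

text \<open>\<open>u\<close> and \<open>p\<close> both lie in the clique \<open>P w\<close>, whose
  maximum is \<open>p\<close>.\<close>

lemma pre_parent: "(p, w) \<in> parent \<Longrightarrow> u \<in> P w \<Longrightarrow> u = p \<or> u \<in> P p"
  using parentD[of p w] parent_max[of p w u] pre_clique[of w u p] P_sub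
  unfolding pre_def[of A V p] by fastforce

lemma T_self: "v \<in> T v"
  unfolding T_def by simp

lemma T_sub:
  assumes "v \<in> V"
  shows "T v \<subseteq> V"
proof
  fix w assume "w \<in> T v"
  then have "(v, w) \<in> parent\<^sup>*" unfolding T_def by simp
  then show "w \<in> V" using assms by induction (auto dest: parentD)
qed

lemma finT: "v \<in> V \<Longrightarrow> finite (T v)"
  using T_sub fin finite_subset by blast

lemma T_ge: "w \<in> T v \<Longrightarrow> v \<le> w"
proof -
  assume "w \<in> T v"
  then have "(v, w) \<in> parent\<^sup>*" unfolding T_def by simp
  then show ?thesis by induction (auto dest: parentD)
qed

lemma T_trans: "w \<in> T v \<Longrightarrow> T w \<subseteq> T v"
  unfolding T_def by auto

text \<open>Climbing from \<open>w\<close> to \<open>v\<close>, \<open>u\<close> is either met on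
  the way or handed on as a preceding neighbour of the next ancestor.\<close>

lemma pre_T: "w \<in> T v \<Longrightarrow> u \<in> P w \<Longrightarrow> u \<in> T v \<or> u \<in> P v"
proof -
  assume "w \<in> T v" "u \<in> P w"
  then have "(v, w) \<in> parent\<^sup>*" unfolding T_def by simp
  then show ?thesis using \<open>u \<in> P w\<close>
  proof (induction arbitrary: u)
    case (step y z)
    then have "u = y \<or> u \<in> P y" using pre_parent by blast
    then show ?case using step unfolding T_def by blast
  qed simp
qed

lemma pre_imp_T: "u \<in> V \<Longrightarrow> w \<in> P u \<Longrightarrow> u \<in> T w"
proof (induction "card {x \<in> V. x < u}" arbitrary: u rule: less_induct)
  case less
  obtain p where p: "(p, u) \<in> parent" using parent_exists less.prems by blast
  then have pV: "p \<in> V" "p < u" using parentD by auto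
  have "{x \<in> V. x < p} \<subset> {x \<in> V. x < u}" using pV by auto
  then have "card {x \<in> V. x < p} < card {x \<in> V. x < u}" using fin by (simp add: psubset_card_mono)
  moreover have "w = p \<or> w \<in> P p" using pre_parent[OF p] less.prems by blast
  ultimately have "p \<in> T w" using less.hyps[of p] pV T_self by blast
  then show ?case using p unfolding T_def by (simp add: rtrancl.rtrancl_into_rtrancl)
qed

lemma adj_cases: "u \<in> V \<Longrightarrow> w \<in> V \<Longrightarrow> adj A u w \<Longrightarrow> u \<in> P w \<or> w \<in> P u"
  unfolding pre_def using irrefl by (metis (mono_tags, lifting) adj_def linorder_neqE mem_Collect_eq)

text \<open>Edges join ancestors to descendants, so one leaving \<open>T v\<close> goes up, where
  \<open>pre_T\<close> applies. Thus \<open>P v\<close> separates \<open>T v\<close> from the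
  rest.\<close>

lemma T_boundary:
  assumes "v \<in> V" "w \<in> T v" "u \<in> V" "adj A u w"
  shows "u \<in> T v \<or> u \<in> P v"
proof -
  have "w \<in> V" using assms T_sub by blast
  then consider "u \<in> P w" | "w \<in> P u" using adj_cases assms by blast
  then show ?thesis
    using pre_T assms pre_imp_T T_trans by cases blast+
qed

lemma T_disjoint:
  assumes "(v, c) \<in> parent" "(v, d) \<in> parent" "c \<noteq> d"
  shows "T c \<inter> T d = {}"
proof -
  \<comment> \<open>Otherwise \<open>v\<close>, the parent of \<open>c\<close>, would be a
    descendant of its own child \<open>d\<close>.\<close>
  have not_desc: "c \<notin> T d" if vc: "(v, c) \<in> parent" and vd: "(v, d) \<in> parent" and "c \<noteq> d" for c d
  proof
    assume "c \<in> T d"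
    then have "(d, c) \<in> parent\<^sup>*" unfolding T_def by simp
    then obtain e where "(d, e) \<in> parent\<^sup>*" "(e, c) \<in> parent"
      using \<open>c \<noteq> d\<close> by (cases rule: rtranclE) auto
    then have "v \<in> T d" using parent_unique[OF vc] unfolding T_def by blast
    then show False using T_ge parentD[OF vd] by fastforce
  qed
  \<comment> \<open>Parents are unique, so the ancestors of \<open>w\<close> form a chain.\<close>
  have "c \<in> T d \<or> d \<in> T c" if "w \<in> T c" "w \<in> T d" for w
  proof -
    have "(c, w) \<in> parent\<^sup>*" "(d, w) \<in> parent\<^sup>*" using that unfolding T_def by auto
    then show ?thesis
    proof (induction arbitrary: rule: rtrancl_induct)
      case base
      then show ?case unfolding T_def by simp
    next
      case (step y z)
      from step.prems show ?case
      proof (cases rule: rtranclE)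
        case base
        then show ?thesis using step.hyps unfolding T_def by (simp add: rtrancl.rtrancl_into_rtrancl)
      next
        case (step x)
        then show ?thesis using \<open>(y, z) \<in> parent\<close> parent_unique \<open>(d, y) \<in> parent\<^sup>* \<Longrightarrow> c \<in> T d \<or> d \<in> T c\<close> by metis
      qed
    qed
  qed
  then show ?thesis using not_desc assms by blast
qed

lemma T_children: "T v = insert v (\<Union>c\<in>{c. (v, c) \<in> parent}. T c)"
proof (rule set_eqI)
  fix w
  have "(v, w) \<in> parent\<^sup>* \<longleftrightarrow> w = v \<or> (\<exists>c. (v, c) \<in> parent \<and> (c, w) \<in> parent\<^sup>*)"
    by (metis converse_rtranclE converse_rtrancl_into_rtrancl rtrancl.rtrancl_refl)
  then show "w \<in> T v \<longleftrightarrow> w \<in> insert v (\<Union>c\<in>{c. (v, c) \<in> parent}. T c)"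
    unfolding T_def by auto
qed

text \<open>\<open>v\<close> takes one of the at most \<open>k\<close> places of \<open>P c\<close>
  without being in \<open>P v\<close>; the bound on \<open>P v \<inter> P c\<close> is what permits
  sparing a vertex of a full \<open>P v\<close>.\<close>

lemma child_pre:
  assumes "(v, c) \<in> parent"
  shows "v \<in> P c" "P c \<subseteq> insert v (P v)" "card (P v \<inter> P c) < k" "c \<in> V" "v \<notin> P v" "v \<notin> T c"
proof -
  show v: "v \<in> P c" "c \<in> V" using parentD[OF assms] by auto
  show "P c \<subseteq> insert v (P v)" using pre_parent[OF assms] by blast
  show vP: "v \<notin> P v" using P_less by blast
  have "card (P v \<inter> P c) < card (P c)" using v vP finP by (intro psubset_card_mono) auto
  then show "card (P v \<inter> P c) < k" using pre_card[OF v(2)] by simp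
  show "v \<notin> T c" using T_ge parentD[OF assms] by fastforce
qed

lemma P_T_disjoint: "P v \<inter> T v = {}"
  using P_less T_ge by fastforce

section \<open>Cyclic triangles at a branch\<close>

lemma reducibleI:
  assumes "F \<subseteq> V" "H \<subseteq> V" "F \<inter> H = {}" "H \<noteq> {}"
    "3 * (card F + card H) \<le> (k + 3) * card H"
    "\<And>h x y. h \<in> H \<Longrightarrow> x \<in> V - F \<Longrightarrow> y \<in> V - F \<Longrightarrow> \<not> cyc A h x y"
  shows "reducible A V k"
  unfolding reducible_def
  by (intro exI[of _ F] exI[of _ H] conjI ballI assms Un_least) assumption+

lemma branch_free:
  assumes "c \<in> V" "triangle_free A ((T c \<union> P c) - F)" "h \<in> T c - F" "x \<in> V - F" "y \<in> V - F"
  shows "\<not> cyc A h x y"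
proof
  assume h: "cyc A h x y"
  then have "x \<in> T c \<union> P c" "y \<in> T c \<union> P c"
    using T_boundary[OF assms(1), of h] cyc_adj[OF h] adj_sym assms(3-5) by blast+
  then show False using h assms unfolding triangle_free_def by blast
qed

text \<open>\<open>c\<close>, \<open>w\<close>, \<open>z\<close> are pairwise adjacent, so an outer
  neighbour of \<open>z\<close> shares the clique \<open>P z\<close> with \<open>w\<close> and is
  adjacent to \<open>w\<close> too. As \<open>c\<close> takes a place in \<open>P w\<close>, fewer
  than \<open>k\<close> outer vertices see \<open>w\<close> or \<open>z\<close>.\<close>

lemma cyclic_branch:
  assumes "c \<in> V" "card (T c) = 3" "\<not> triangle_free A (T c)"
  obtains w z where "T c = {c, w, z}" "c \<noteq> w" "c \<noteq> z" "w \<noteq> z" "card (P w - {c}) < k"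
    "\<And>u. u \<in> V - T c \<Longrightarrow> adj A u w \<or> adj A u z \<Longrightarrow> u \<in> P w"
proof -
  have f: "finite (T c)" using finT assms by blast
  have "card (T c - {c}) = 2" using assms f T_self by simp
  then obtain a b where ab: "T c - {c} = {a, b}" "a \<noteq> b" by (meson card_2_iff)
  obtain w z where wz: "T c - {c} = {w, z}" "w < z"
    using ab by (metis insert_commute linorder_neqE)
  then have T: "T c = {c, w, z}" using T_self by blast
  have ne: "c \<noteq> w" "c \<noteq> z" "w \<noteq> z" using wz by auto
  have lt: "c < w" "c < z" using T_ge[of w c] T_ge[of z c] T ne by auto
  have V: "w \<in> V" "z \<in> V" using T_sub[OF assms(1)] T by auto
  have "cyc A c w z \<or> cyc A c z w" using assms(3) unfolding T triangle_free_3 by blast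
  then have ad: "adj A c w" "adj A c z" "adj A w z" unfolding cyc_def adj_def by auto
  then have P: "c \<in> P w" "c \<in> P z" "w \<in> P z"
    using V assms(1) lt wz(2) unfolding pre_def by auto
  have "card (P w - {c}) < card (P w)" using P finP by (meson card_Diff1_less)
  then have "card (P w - {c}) < k" using pre_card[OF V(1)] by simp
  moreover have "u \<in> P w" if u: "u \<in> V - T c" "adj A u w \<or> adj A u z" for u
  proof -
    have "u \<in> P c" using T_boundary[OF assms(1), of _ u] u T by blast
    then have "u < c" using P_less by blast
    moreover have "adj A u w"
    proof (cases "adj A u z")
      case True
      then have "u \<in> P z" using u(1) \<open>u < c\<close> lt unfolding pre_def by auto
      then show ?thesis using pre_clique[OF V(2) _ P(3)] u(1) T by blast
    qed (use u in blast)
    ultimately show ?thesis using u(1) lt unfolding pre_def by auto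
  qed
  ultimately show thesis using that[of w z] T ne by blast
qed

subsection \<open>Reducible configurations\<close>

text \<open>Deletes \<open>F\<close> and \<open>T v - H\<close>. The vertices of
  \<open>P v - F\<close> stay undecided, which is why they enter the triangle condition.\<close>

lemma single_branch_reducible:
  assumes "v \<in> V" "F \<subseteq> P v" "H \<subseteq> T v" "H \<noteq> {}" "triangle_free A (H \<union> (P v - F))"
    "3 * (card F + card (T v)) \<le> (k + 3) * card H"
  shows "reducible A V k"
proof (rule reducibleI[of "F \<union> (T v - H)" H])
  have f: "finite F" "finite (T v)" "finite H"
    using finite_subset[OF _ finP] finT finite_subset[OF _ finT] assms by blast+
  have "card (T v - H) + card H = card (T v)"
    using assms(3) f by (metis card_Diff_subset card_mono le_add_diff_inverse2)
  moreover have "card (F \<union> (T v - H)) \<le> card F + card (T v - H)" by (rule card_Un_le)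
  ultimately have "card (F \<union> (T v - H)) + card H \<le> card F + card (T v)" by linarith
  then show "3 * (card (F \<union> (T v - H)) + card H) \<le> (k + 3) * card H"
    using assms(6) by (meson le_trans mult_le_mono2)
  show "F \<union> (T v - H) \<subseteq> V" "H \<subseteq> V" "H \<noteq> {}"
    using assms P_sub T_sub by blast+
  show "(F \<union> (T v - H)) \<inter> H = {}" using assms(2,3) P_T_disjoint by blast
  have "T v \<union> P v - (F \<union> (T v - H)) \<subseteq> H \<union> (P v - F)" by blast
  then have tf: "triangle_free A (T v \<union> P v - (F \<union> (T v - H)))"
    using triangle_free_mono[OF assms(5)] by blast
  have "H \<subseteq> T v - (F \<union> (T v - H))" using assms(2,3) P_T_disjoint by blast
  then show "\<not> cyc A h x y"
    if "h \<in> H" "x \<in> V - (F \<union> (T v - H))" "y \<in> V - (F \<union> (T v - H))" for h x y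
    using branch_free[OF assms(1) tf] that by blast
qed

text \<open>Both branches have their boundaries inside \<open>insert v (P v)\<close>, so
  \<open>F\<close> is paid for once and two kept sets are gained.\<close>

lemma two_branches_reducible:
  assumes c: "(v, c) \<in> parent" and d: "(v, d) \<in> parent" and "c \<noteq> d"
    and F: "F \<subseteq> insert v (P v)"
    and Hc: "Hc \<subseteq> T c" "Hc \<noteq> {}" "triangle_free A (Hc \<union> (P c - F))"
    and Hd: "Hd \<subseteq> T d" "triangle_free A (Hd \<union> (P d - F))"
    and num: "3 * (card F + card (T c) + card (T d)) \<le> (k + 3) * (card Hc + card Hd)"
  shows "reducible A V k"
proof -
  let ?F = "F \<union> (T c - Hc) \<union> (T d - Hd)"
  have V: "v \<in> V" "c \<in> V" "d \<in> V" using parentD c d by auto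
  have f: "finite F" "finite (T c)" "finite (T d)" "finite Hc" "finite Hd"
    using finite_subset[OF F] finP finT V finite_subset[OF Hc(1)] finite_subset[OF Hd(1)] by auto
  have disj: "T c \<inter> T d = {}" using T_disjoint c d \<open>c \<noteq> d\<close> by blast
  have "T c \<subseteq> T v" "T d \<subseteq> T v" using T_children[of v] c d by blast+
  then have Fd: "F \<inter> T c = {}" "F \<inter> T d = {}"
    using F P_T_disjoint[of v] child_pre(6)[OF c] child_pre(6)[OF d] by blast+
  have "card (T c - Hc) + card Hc = card (T c)" "card (T d - Hd) + card Hd = card (T d)"
    using Hc Hd f by (metis card_Diff_subset card_mono le_add_diff_inverse2)+
  moreover have "card ?F \<le> card F + card (T c - Hc) + card (T d - Hd)"
    using card_Un_le[of "F \<union> (T c - Hc)" "T d - Hd"] card_Un_le[of F "T c - Hc"] by linarith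
  moreover have cH: "card (Hc \<union> Hd) = card Hc + card Hd"
    using disj Hc Hd f by (intro card_Un_disjoint) auto
  ultimately have "card ?F + card (Hc \<union> Hd) \<le> card F + card (T c) + card (T d)" by linarith
  then have n: "3 * (card ?F + card (Hc \<union> Hd)) \<le> (k + 3) * card (Hc \<union> Hd)"
    using num unfolding cH by (meson le_trans mult_le_mono2)
  have "T c \<union> P c - ?F \<subseteq> Hc \<union> (P c - F)" "T d \<union> P d - ?F \<subseteq> Hd \<union> (P d - F)" by blast+
  then have tf: "triangle_free A (T c \<union> P c - ?F)" "triangle_free A (T d \<union> P d - ?F)"
    using triangle_free_mono Hc(3) Hd(2) by blast+
  have H: "Hc \<subseteq> T c - ?F" "Hd \<subseteq> T d - ?F" using Hc(1) Hd(1) Fd disj by blast+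
  show ?thesis
  proof (rule reducibleI[of ?F "Hc \<union> Hd"])
    show "?F \<subseteq> V" "Hc \<union> Hd \<subseteq> V"
      using F P_sub T_sub V Hc(1) Hd(1) by blast+
    show "?F \<inter> (Hc \<union> Hd) = {}" using H by blast
    show "Hc \<union> Hd \<noteq> {}" using Hc by blast
    show "\<not> cyc A h x y" if "h \<in> Hc \<union> Hd" "x \<in> V - ?F" "y \<in> V - ?F" for h x y
    proof (cases "h \<in> Hc")
      case True
      then have "h \<in> T c - ?F" using H(1) by (rule rev_subsetD)
      then show ?thesis using branch_free[OF V(2) tf(1)] that(2,3) by simp
    next
      case False
      then have "h \<in> T d - ?F" using H(2) that(1) by (meson UnE subsetD)
      then show ?thesis using branch_free[OF V(3) tf(2)] that(2,3) by simp
    qed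
  qed (rule n)
qed

text \<open>Once \<open>P v\<close> is deleted, a leaf can only be adjacent to \<open>v\<close>, so
  it lies in no triangle. The cost is at most \<open>3(k + 3)\<close> for three kept
  vertices.\<close>

lemma three_leaves_reducible:
  assumes "(v, a) \<in> parent" "(v, b) \<in> parent" "(v, c) \<in> parent"
    and ne: "a \<noteq> b" "b \<noteq> c" "a \<noteq> c"
    and T: "T a = {a}" "T b = {b}" "T c = {c}"
  shows "reducible A V k"
proof (rule reducibleI[of "P v" "{a, b, c}"])
  have V: "v \<in> V" "a \<in> V" "b \<in> V" "c \<in> V" using assms parentD by blast+
  have "card {a, b, c} = 3" using ne by simp
  then show "3 * (card (P v) + card {a, b, c}) \<le> (k + 3) * card {a, b, c}"
    using pre_card[OF V(1)] by simp
  show "P v \<subseteq> V" "{a, b, c} \<subseteq> V" using P_sub V by auto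
  have nP: "x \<notin> P v" if "(v, x) \<in> parent" for x
    using parentD[OF that] P_less by fastforce
  then show "P v \<inter> {a, b, c} = {}" using assms by blast
  have tf: "triangle_free A (T x \<union> P x - P v)" if "(v, x) \<in> parent" "T x = {x}" for x
  proof (rule triangle_free_mono)
    show "triangle_free A {x, v}"
      by (rule triangle_free_card_le_2) (auto simp: card_insert_if)
    show "T x \<union> P x - P v \<subseteq> {x, v}" using child_pre[OF that(1)] that(2) by blast
  qed
  show "\<not> cyc A h x y" if "h \<in> {a, b, c}" "x \<in> V - P v" "y \<in> V - P v" for h x y
  proof -
    have h: "(v, h) \<in> parent" "T h = {h}" "h \<in> V" using that assms V by auto
    show ?thesis using branch_free[OF h(3) tf[OF h(1,2)], of h x y] h(2) nP[OF h(1)] that by blast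
  qed
qed simp

text \<open>Sparing \<open>Y\<close> leaves at most \<open>k - 1\<close> boundary deletions, and
  keeping three of four vertices gives \<open>3((k - 1) + 4) = (k + 3) * 3\<close>.\<close>

lemma single_child_reducible:
  assumes c: "(v, c) \<in> parent" and Tv: "T v = insert v (T c)" and 3: "card (T c) = 3"
  shows "reducible A V k"
proof -
  have V: "v \<in> V" "c \<in> V" using parentD c by auto
  obtain Y where Y: "Y \<subseteq> P v - P c" "card Y \<le> 1" "card (P v - Y) < k"
    using obtain_small_difference[OF finP pre_card[OF V(1)] child_pre(3)[OF c]] .
  have 4: "card (T v) = 4" using 3 child_pre(6)[OF c] finT V unfolding Tv by simp
  then obtain t where t: "t \<in> T v" "triangle_free A (T v - {t})"
    using triple_avoiding_triangle by blast
  have c3: "card (T v - {t}) = 3" using 4 t finT V by simp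
  have one: "x = y" if "x \<in> Y" "y \<in> Y" for x y
    using that Y(2) finite_subset[OF Y(1)] finP by (auto simp: card_le_Suc0_iff_eq)
  have nadj: "\<not> adj A y u" if "y \<in> Y" "u \<in> T c" for y u
    using T_boundary[OF V(2) that(2), of y] that Y P_sub P_T_disjoint[of v] Tv by blast
  \<comment> \<open>Both other vertices of such a triangle would be neighbours of \<open>y\<close>,
    hence equal to \<open>v\<close>.\<close>
  have no: "\<not> cyc A y a b" if "y \<in> Y" "a \<in> T v \<union> Y" "b \<in> T v \<union> Y" for y a b
  proof
    assume h: "cyc A y a b"
    have "a = v" "b = v"
      using that cyc_adj[OF h] cyc_distinct[OF h] nadj adj_sym one Tv by blast+
    then show False using cyc_distinct[OF h] by blast
  qed
  have "triangle_free A ((T v - {t}) \<union> Y)"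
    unfolding triangle_free_def
  proof (intro ballI notI)
    fix x y z
    assume h: "x \<in> (T v - {t}) \<union> Y" "y \<in> (T v - {t}) \<union> Y" "z \<in> (T v - {t}) \<union> Y" "cyc A x y z"
    then have "cyc A y z x" "cyc A z x y" unfolding cyc_def by auto
    then have "x \<notin> Y" "y \<notin> Y" "z \<notin> Y" using no h by blast+
    then show False using t(2) h unfolding triangle_free_def by blast
  qed
  moreover have "P v - (P v - Y) = Y" using Y by blast
  moreover have "T v - {t} \<noteq> {}" using c3 by force
  ultimately show ?thesis
    using Y(3) c3 4 by (intro single_branch_reducible[OF V(1), of "P v - Y" "T v - {t}"]) auto
qed

text \<open>For two pairs the whole boundary is deleted: \<open>3(k + 1 + 4) \<le> 4(k + 3)\<close>
  when \<open>k \<ge> 3\<close>. Otherwise a vertex outside \<open>P c\<close> is spared; the pair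
  \<open>T c\<close> still loses its entire boundary and is kept whole, while \<open>T d\<close> is
  trimmed.\<close>

lemma pair_child_reducible:
  assumes c: "(v, c) \<in> parent" and d: "(v, d) \<in> parent" and "c \<noteq> d" and k: "3 \<le> k"
    and 2: "card (T c) = 2" and Td: "card (T d) \<in> {1, 2, 3}"
  shows "reducible A V k"
proof (cases "card (T d) = 2")
  case True
  have V: "v \<in> V" "c \<in> V" "d \<in> V" using parentD c d by auto
  have "card (insert v (P v)) \<le> k + 1" using pre_card[OF V(1)] child_pre(5)[OF c] finP by simp
  moreover have empty: "P c - insert v (P v) = {}" "P d - insert v (P v) = {}"
    using child_pre(2) c d by blast+
  have "triangle_free A (T c \<union> (P c - insert v (P v)))"
    "triangle_free A (T d \<union> (P d - insert v (P v)))"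
    unfolding empty Un_empty_right using triangle_free_card_le_2 finT V 2 True by simp_all
  moreover have "T c \<noteq> {}" using T_self by blast
  ultimately show ?thesis
    using 2 True k
    by (intro two_branches_reducible[OF c d \<open>c \<noteq> d\<close>, of "insert v (P v)" "T c" "T d"]) auto
next
  case False
  have V: "v \<in> V" "c \<in> V" "d \<in> V" using parentD c d by auto
  obtain Y where Y: "Y \<subseteq> P v - P c" "card Y \<le> 1" "card (P v - Y) < k"
    using obtain_small_difference[OF finP pre_card[OF V(1)] child_pre(3)[OF c]] .
  let ?F = "insert v (P v - Y)"
  have fY: "finite Y" using finite_subset[OF Y(1)] finP by blast
  have "card (T d) = 1 \<or> card (T d) = 3" using Td False by simp
  then obtain H where H: "H \<subseteq> T d" "triangle_free A (H \<union> Y)" "card H = 1 \<or> card H = 2"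
    "card (T d - H) + 1 = card H"
    using split_branch[OF _ Y(2) fY] by blast
  have "card (T d) = card (T d - H) + card H"
    using H(1) finT[OF V(3)] by (metis card_Diff_subset card_mono finite_subset le_add_diff_inverse2)
  then have Hd: "card (T d) + 1 = 2 * card H" using H(4) by simp
  have cF: "card ?F \<le> k" using Y(3) finP child_pre(5)[OF c] by simp
  have empty: "P c - ?F = {}" using child_pre(2)[OF c] Y by blast
  have tc: "triangle_free A (T c \<union> (P c - ?F))"
    unfolding empty Un_empty_right using triangle_free_card_le_2 finT V 2 by simp
  have "P d - ?F \<subseteq> Y" using child_pre(2)[OF d] by blast
  then have td: "triangle_free A (H \<union> (P d - ?F))"
    by (intro triangle_free_mono[OF H(2)]) blast
  \<comment> \<open>With \<open>|T d| = 2|H| - 1\<close>, the left side is at most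
    \<open>3(k + 3)\<close> for \<open>|H| = 1\<close> and \<open>3(k + 5)\<close> for
    \<open>|H| = 2\<close>; the latter uses \<open>k \<ge> 3\<close>.\<close>
  have "3 * (card ?F + card (T c) + card (T d)) \<le> (k + 3) * (card (T c) + card H)"
    using H(3) Hd cF k 2 by auto
  then show ?thesis
    using two_branches_reducible[OF c d \<open>c \<noteq> d\<close>, of ?F "T c" H] tc td H(1) T_self by blast
qed

lemma cyclic_child_reducible:
  assumes c: "(v, c) \<in> parent" and d: "(v, d) \<in> parent" and "c \<noteq> d" and k: "3 \<le> k"
    and 3: "card (T c) = 3" "\<not> triangle_free A (T c)" and Td: "card (T d) = 1 \<or> card (T d) = 3"
  shows "reducible A V k"
proof -
  have V: "v \<in> V" "c \<in> V" "d \<in> V" using parentD c d by auto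
  \<comment> \<open>With two vertices of \<open>T c\<close> kept, the count is
    \<open>3(k + 1 + 2|H|) \<le> (k + 3)(2 + |H|)\<close>. It asks for
    \<open>|F| \<le> k - 1\<close>, so up to two vertices of \<open>insert v (P v)\<close> must be
    spared.\<close>
  have red: "reducible A V k"
    if F: "F \<subseteq> insert v (P v)" "card F < k" and Y: "P d - F \<subseteq> Y" "card Y \<le> 1" "finite Y"
      and Hc: "Hc \<subseteq> T c" "card Hc = 2" "triangle_free A (Hc \<union> (P c - F))" for F Y Hc
  proof -
    obtain H where H: "H \<subseteq> T d" "triangle_free A (H \<union> Y)" "card H = 1 \<or> card H = 2"
      "card (T d - H) + 1 = card H"
      using split_branch[OF Td Y(2,3)] by blast
    have "card (T d) = card (T d - H) + card H"
      using H(1) finT[OF V(3)] by (metis card_Diff_subset card_mono finite_subset le_add_diff_inverse2)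
    then have Hd: "card (T d) + 1 = 2 * card H" using H(4) by simp
    have td: "triangle_free A (H \<union> (P d - F))"
      by (intro triangle_free_mono[OF H(2)]) (use Y in blast)
    have "3 * (card F + card (T c) + card (T d)) \<le> (k + 3) * (card Hc + card H)"
      using H(3) Hd F(2) k 3(1) Hc(2) by auto
    moreover have "Hc \<noteq> {}" using Hc(2) by force
    ultimately show ?thesis
      using two_branches_reducible[OF c d \<open>c \<noteq> d\<close> F(1) Hc(1) _ Hc(3) H(1) td] by blast
  qed
  show ?thesis
  proof (cases "card (P v \<inter> (P c \<union> P d)) < k")
    case True
    \<comment> \<open>Spare a common non-neighbour of both branches, and a second vertex that is seen from the
      cyclic triangle \<open>T c\<close> only by \<open>c\<close> itself, which is deleted.\<close>
    then obtain Y where Y: "Y \<subseteq> P v - (P c \<union> P d)" "card Y \<le> 1" "card (P v - Y) < k"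
      using obtain_small_difference[OF finP pre_card[OF V(1)]] by blast
    let ?X = "insert v (P v - Y)"
    have X: "finite ?X" "card ?X \<le> k" using Y(3) finP child_pre(5)[OF c] by auto
    obtain w z where wz: "T c = {c, w, z}" "c \<noteq> w" "c \<noteq> z" "w \<noteq> z" "card (P w - {c}) < k"
      "\<And>u. u \<in> V - T c \<Longrightarrow> adj A u w \<or> adj A u z \<Longrightarrow> u \<in> P w"
      using cyclic_branch[OF V(2) 3] by metis
    have XT: "?X \<inter> T c = {}"
      using P_T_disjoint[of v] T_children[of v] c child_pre(6)[OF c] by blast
    \<comment> \<open>\<open>c\<close> fills a place of \<open>P w\<close> outside
      \<open>?X\<close>, so if \<open>|?X| = k\<close>, some element of \<open>?X\<close> is seen by
      neither \<open>w\<close> nor \<open>z\<close>.\<close>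
    then have "?X \<inter> P w \<subseteq> P w - {c}" using T_self by blast
    then have "card (?X \<inter> P w) < k" using wz(5) finP
      by (meson card_mono finite_Diff le_less_trans)
    then obtain Y' where Y': "Y' \<subseteq> ?X - P w" "card Y' \<le> 1" "card (?X - Y') < k"
      using obtain_small_difference[OF X] by blast
    have fY': "finite Y'" using finite_subset[OF Y'(1)] X(1) by blast
    have "Y' \<subseteq> V - T c" using Y'(1) XT P_sub V by blast
    then have nadj: "\<not> adj A y w" "\<not> adj A y z" if "y \<in> Y'" for y
      using wz(6) that Y'(1) by blast+
    have "triangle_free A ({w, z} \<union> Y')"
      unfolding triangle_free_def
    proof (intro ballI notI)
      fix a b e assume h: "a \<in> {w, z} \<union> Y'" "b \<in> {w, z} \<union> Y'" "e \<in> {w, z} \<union> Y'" "cyc A a b e"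
      have one: "x = y" if "x \<in> Y'" "y \<in> Y'" for x y
        using that Y'(2) fY' by (auto simp: card_le_Suc0_iff_eq)
      show False
        using h cyc_adj[OF h(4)] cyc_distinct[OF h(4)] nadj adj_sym one by (metis Un_iff insertE singletonD)
    qed
    \<comment> \<open>\<open>Y\<close> avoids \<open>P c\<close> and \<open>P d\<close>, so the only
      spared vertices either branch can see are in \<open>Y'\<close>.\<close>
    moreover have sub: "P c - (?X - Y') \<subseteq> Y'" "P d - (?X - Y') \<subseteq> Y'"
      using child_pre(2)[OF c] child_pre(2)[OF d] Y(1) by blast+
    ultimately have "triangle_free A ({w, z} \<union> (P c - (?X - Y')))"
      by (elim triangle_free_mono) blast
    then show ?thesis
      using red[OF _ Y'(3) sub(2) Y'(2) fY', of "{w, z}"] wz by auto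
  next
    case False
    \<comment> \<open>Spare one non-neighbour of each branch; each is seen by the other branch only.\<close>
    have "card (P v \<inter> (P c \<union> P d)) \<le> card (P v)" using finP by (simp add: card_mono)
    then have Pk: "card (P v) = k" "card (P v \<inter> (P c \<union> P d)) = card (P v)"
      using False pre_card[OF V(1)] by auto
    then have sub: "P v \<subseteq> P c \<union> P d"
      using card_subset_eq[OF finP, of "P v \<inter> (P c \<union> P d)" v] by blast
    have "\<not> P v \<subseteq> P c" "\<not> P v \<subseteq> P d"
      using child_pre(3)[OF c] child_pre(3)[OF d] Pk(1) by (metis inf.absorb1 less_irrefl)+
    then obtain yc yd where y: "yc \<in> P v - P c" "yd \<in> P v - P d" by blast
    then have "yc \<noteq> yd" using sub by blast
    let ?F = "insert v (P v - {yc, yd})"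
    have "card (P v - {yc, yd}) = k - 2"
      using y \<open>yc \<noteq> yd\<close> Pk(1) finP by (simp add: card_Diff_subset)
    \<comment> \<open>Adding \<open>v\<close> to these \<open>k - 2\<close> vertices gives
      \<open>k - 1\<close> deletions.\<close>
    then have cF: "card ?F < k" using k finP child_pre(5)[OF c] by simp
    have Pc: "P c - ?F \<subseteq> {yd}" and Pd: "P d - ?F \<subseteq> {yc}"
      using child_pre(2)[OF c] child_pre(2)[OF d] y by blast+
    obtain t where t: "t \<in> T c" "triangle_free A (insert yd (T c - {t}))"
      using pair_avoiding_triangle[OF 3(1)] .
    have "triangle_free A ((T c - {t}) \<union> (P c - ?F))"
      by (rule triangle_free_mono[OF t(2)]) (use Pc in blast)
    moreover have "card (T c - {t}) = 2" using t 3(1) finT[OF V(2)] by simp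
    ultimately show ?thesis using red[OF _ cF Pd, of "T c - {t}"] by auto
  qed
qed

section \<open>Choosing a configuration\<close>

lemma small_tree_reducible:
  assumes "v \<in> V" "P v = {}" "card (T v) \<le> 3" "2 \<le> k"
  shows "reducible A V k"
proof (cases "triangle_free A (T v)")
  case True
  then show ?thesis
    using assms T_self by (intro single_branch_reducible[of v "{}" "T v"]) auto
next
  case False
  then have "card (T v) = 3"
    using triangle_free_card_le_2[OF finT[OF assms(1)]] assms(3) by linarith
  \<comment> \<open>Only \<open>v\<close> is dropped: \<open>3 * 3 \<le> (k + 3) * 2\<close> holds
    from \<open>k = 2\<close> on.\<close>
  moreover from this have "card (T v - {v}) = 2" using T_self finT[OF assms(1)] by simp
  moreover from this have "triangle_free A (T v - {v})" "T v - {v} \<noteq> {}"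
    using triangle_free_card_le_2 finT[OF assms(1)] by force+
  ultimately show ?thesis
    using assms by (intro single_branch_reducible[of v "{}" "T v - {v}"]) auto
qed

text \<open>If all trees are small, the first vertex has an empty boundary. Otherwise children of
  the last vertex with a large tree come later and have at most three descendants; their number and
  sizes select the configuration.\<close>

lemma reducible_if_large:
  assumes "V \<noteq> {}" "3 \<le> k"
  shows "reducible A V k"
proof (cases "\<exists>v\<in>V. 4 \<le> card (T v)")
  case False
  let ?v = "Min V"
  have "?v \<in> V" using assms fin by simp
  moreover have "P ?v = {}" unfolding pre_def using fin by (auto simp: not_less)
  ultimately show ?thesis using small_tree_reducible[of ?v] False assms by (auto simp: not_le)
next
  case True
  define M where "M = {v \<in> V. 4 \<le> card (T v)}"
  define v where "v = Max M"
  have M: "finite M" "M \<noteq> {}" using fin True unfolding M_def by auto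
  have v: "v \<in> V" "4 \<le> card (T v)" using Max_in[OF M] unfolding v_def M_def by auto
  define C where "C = {c. (v, c) \<in> parent}"
  have CV: "C \<subseteq> V" using parentD unfolding C_def by blast
  have fC: "finite C" using CV fin finite_subset by blast
  have le3: "card (T c) \<le> 3" if "c \<in> C" for c
  proof (rule ccontr)
    assume "\<not> card (T c) \<le> 3"
    then have "c \<in> M" using that CV unfolding M_def by auto
    then have "c \<le> v" using M unfolding v_def by simp
    then show False using parentD that unfolding C_def by fastforce
  qed
  have ge1: "1 \<le> card (T c)" if "c \<in> C" for c
    using that CV finT T_self by (metis One_nat_def Suc_leI card_gt_0_iff empty_iff subsetD)
  have Tv: "T v = insert v (\<Union>c\<in>C. T c)" using T_children unfolding C_def .
  show ?thesis
  proof (rule ccontr)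
    assume nr: "\<not> reducible A V k"
    \<comment> \<open>A triangle-free triple is kept whole at the price of \<open>P c\<close>, so
      only cyclic triples remain.\<close>
    have cyclic: "\<not> triangle_free A (T c)" if "c \<in> C" "card (T c) = 3" for c
    proof
      assume "triangle_free A (T c)"
      then have "reducible A V k"
        using that CV pre_card T_self
        by (intro single_branch_reducible[of c "P c" "T c"]) auto
      then show False using nr by blast
    qed
    have "C \<noteq> {}" using v(2) Tv by auto
    then obtain c where c: "c \<in> C" by blast
    have "C \<noteq> {c}"
    proof
      assume C: "C = {c}"
      then have "card (T v) \<le> 1 + card (T c)" using Tv by (simp add: card_insert_le_m1)
      then have "card (T c) = 3" using v(2) le3[OF c] by simp
      then have "reducible A V k" using single_child_reducible[of v c] c Tv C unfolding C_def by auto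
      then show False using nr by blast
    qed
    then obtain e where "e \<in> C" "e \<noteq> c" using c by blast
    then have other: "\<exists>d\<in>C. d \<noteq> a" for a using c by metis
    \<comment> \<open>A child with two or three descendants yields a configuration together with a
      sibling, so all children are leaves.\<close>
    have one: "card (T a) = 1" if a: "a \<in> C" for a
    proof (rule ccontr)
      assume "card (T a) \<noteq> 1"
      then have two_three: "card (T a) = 2 \<or> card (T a) = 3" using le3[OF a] ge1[OF a] by linarith
      obtain d where d: "d \<in> C" "d \<noteq> a" using other by blast
      have sizes: "card (T d) \<in> {1, 2, 3}" "card (T a) \<in> {1, 2, 3}"
        using le3[OF d(1)] ge1[OF d(1)] two_three by auto
      have par: "(v, a) \<in> parent" "(v, d) \<in> parent" using a d unfolding C_def by auto
      consider "card (T a) = 2" | "card (T d) = 2"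
        | "card (T a) = 3" "card (T d) = 1 \<or> card (T d) = 3"
        using two_three sizes by auto
      then have "reducible A V k"
        using pair_child_reducible[OF par] pair_child_reducible[OF par(2,1)]
          cyclic_child_reducible[OF par] d(2) sizes assms(2) cyclic[OF a] by cases auto
      then show False using nr by blast
    qed
    then have leaf: "T a = {a}" if "a \<in> C" for a
      using that T_self by (metis card_1_singletonE singletonD)
    have "T v = insert v C" using Tv leaf by auto
    then have "card (T v) \<le> 1 + card C" using card_insert_le_m1 fC by (simp add: card_insert_if)
    then have "3 \<le> card C" using v(2) by simp
    then obtain S where S: "S \<subseteq> C" "card S = 3" by (meson obtain_subset_with_card_n)
    obtain x y z where "S = {x, y, z}" "x \<noteq> y" "y \<noteq> z" "x \<noteq> z" using card_3_cases[OF S(2)] .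
    then have "reducible A V k"
      using three_leaves_reducible[of v x y z] S(1) leaf unfolding C_def by auto
    then show False using nr by blast
  qed
qed

end

subsection \<open>Large acyclic sets\<close>

lemma elimination_order_subset:
  assumes "elimination_order A V k" "W \<subseteq> V"
  shows "elimination_order A W k"
proof -
  interpret elimination_order A V k by fact
  have sub: "pre A W v \<subseteq> P v" for v using assms(2) unfolding pre_def by blast
  show ?thesis
  proof
    show "finite W" using fin assms(2) finite_subset by blast
    show "card (pre A W v) \<le> k" if "v \<in> W" for v
      using card_mono[OF finP sub[of v]] pre_card[of v] that assms(2) by fastforce
    show "adj A x y" if "v \<in> W" "x \<in> pre A W v" "y \<in> pre A W v" "x \<noteq> y" for v x y
      using pre_clique[of v x y] that sub assms(2) by blast
  qed
qed

text \<open>The last vertex \<open>b\<close> sees at most \<open>k\<close> coloured vertices, so one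
  of the \<open>k + 1\<close> colours is free.\<close>

lemma greedy_colouring:
  assumes "elimination_order A V k"
  shows "\<exists>f :: 'v::linorder \<Rightarrow> nat. (\<forall>v\<in>V. f v \<le> k) \<and> (\<forall>x\<in>V. \<forall>y\<in>V. adj A x y \<longrightarrow> f x \<noteq> f y)"
proof -
  have "finite V" using assms elimination_order.fin by blast
  then show ?thesis using assms
  proof (induction V rule: finite_linorder_max_induct)
    case (insert b V)
    interpret elimination_order A "insert b V" k by fact
    obtain f where f: "\<forall>v\<in>V. f v \<le> k" "\<forall>x\<in>V. \<forall>y\<in>V. adj A x y \<longrightarrow> f x \<noteq> (f y :: nat)"
      using insert.IH elimination_order_subset[OF insert.prems] by blast
    have "card (f ` P b) \<le> k" using card_image_le[OF finP, of f b] pre_card[of b] by simp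
    then have "card (f ` P b) < card {..k}" by simp
    then obtain i where i: "i \<le> k" "i \<notin> f ` P b"
      by (metis atMost_iff card_mono finP finite_imageI not_le subsetI)
    have "b \<notin> V" using insert.hyps by blast
    have new: "f x \<noteq> i" if "x \<in> V" "adj A x b" for x
      using that i(2) insert.hyps unfolding pre_def by blast
    have "(f(b := i)) x \<noteq> (f(b := i)) y" if "x \<in> insert b V" "y \<in> insert b V" "adj A x y" for x y
    proof -
      have "\<not> adj A b b" using irrefl unfolding adj_def by blast
      then show ?thesis using that f(2) new[of x] new[of y] adj_sym \<open>b \<notin> V\<close>
        by (metis fun_upd_apply insertE)
    qed
    moreover have "\<forall>v\<in>insert b V. (f(b := i)) v \<le> k" using f(1) i(1) by simp
    ultimately show ?case by blast
  qed simp
qed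

text \<open>A cyclic triangle needs three colours. For \<open>k < 2\<close> there are too few; for
  \<open>k = 2\<close> dropping a smallest class keeps two thirds of \<open>V\<close>, and
  \<open>5 * 2/3 \<ge> 3\<close>.\<close>

lemma large_triangle_free_small_width:
  assumes "elimination_order A V k" "k \<le> 2"
  shows "\<exists>S\<subseteq>V. 3 * card V \<le> (k + 3) * card S \<and> triangle_free A S"
proof -
  interpret elimination_order A V k by fact
  obtain f where f: "\<forall>v\<in>V. f v \<le> k" "\<forall>x\<in>V. \<forall>y\<in>V. adj A x y \<longrightarrow> f x \<noteq> (f y :: nat)"
    using greedy_colouring[OF assms(1)] by blast
  have missing: "triangle_free A {v \<in> V. f v \<noteq> i}" if "k < 2 \<or> i \<le> 2" for i
    unfolding triangle_free_def
  proof (intro ballI notI)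
    fix x y z
    assume *: "x \<in> {v \<in> V. f v \<noteq> i}" "y \<in> {v \<in> V. f v \<noteq> i}" "z \<in> {v \<in> V. f v \<noteq> i}"
      "cyc A x y z"
    then have "f x \<noteq> f y" "f y \<noteq> f z" "f z \<noteq> f x" using f(2) cyc_adj[OF *(4)] by blast+
    moreover have "f x \<le> k" "f y \<le> k" "f z \<le> k" using f(1) * by blast+
    moreover have "f x \<noteq> i" "f y \<noteq> i" "f z \<noteq> i" using * by blast+
    ultimately show False using that assms(2) by linarith
  qed
  show ?thesis
  proof (cases "k < 2")
    case True
    \<comment> \<open>The colour \<open>k + 1\<close> never occurs, so nothing is discarded.\<close>
    then have "triangle_free A {v \<in> V. f v \<noteq> k + 1}" using missing by blast
    moreover have "{v \<in> V. f v \<noteq> k + 1} = V" using f(1) by fastforce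
    ultimately show ?thesis by auto
  next
    case False
    then have k: "k = 2" using assms(2) by simp
    let ?c = "\<lambda>i. card {v \<in> V. f v = i}"
    have "V = {v \<in> V. f v = 0} \<union> {v \<in> V. f v = 1} \<union> {v \<in> V. f v = 2}"
      using f(1) k by (auto simp: le_Suc_eq numeral_2_eq_2)
    then have "card V = card ({v \<in> V. f v = 0} \<union> {v \<in> V. f v = 1} \<union> {v \<in> V. f v = 2})"
      by simp
    also have "\<dots> = ?c 0 + ?c 1 + ?c 2"
      using fin by (simp add: card_Un_disjoint disjoint_iff)
    finally have "3 * ?c 0 \<le> card V \<or> 3 * ?c 1 \<le> card V \<or> 3 * ?c 2 \<le> card V" by linarith
    then have "\<exists>i\<in>{0, 1, 2}. 3 * ?c i \<le> card V" by blast
    then obtain i where "i \<in> {0, 1, 2}" and i2: "3 * ?c i \<le> card V" by blast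
    then have i: "i \<le> 2" by auto
    have "{v \<in> V. f v \<noteq> i} = V - {v \<in> V. f v = i}" by blast
    then have "card {v \<in> V. f v \<noteq> i} = card V - ?c i" using fin by (simp add: card_Diff_subset)
    then have "3 * card V \<le> (k + 3) * card {v \<in> V. f v \<noteq> i}" using i2 k by simp
    moreover have "triangle_free A {v \<in> V. f v \<noteq> i}" using missing i by simp
    ultimately show ?thesis by (intro exI[of _ "{v \<in> V. f v \<noteq> i}"]) simp
  qed
qed

text \<open>For \<open>k \<ge> 3\<close>, reducible pairs are removed until nothing is left; the
  kept sets are united and their inequalities summed.\<close>

lemma large_triangle_free:
  assumes "elimination_order A V k"
  shows "\<exists>S\<subseteq>V. 3 * card V \<le> (k + 3) * card S \<and> triangle_free A S"
proof (cases "k \<le> 2")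
  case True
  then show ?thesis using large_triangle_free_small_width assms by blast
next
  case False
  from assms show ?thesis
  proof (induction "card V" arbitrary: V rule: less_induct)
    case less
    interpret elimination_order A V k by fact
    show ?case
    proof (cases "V = {}")
      case True
      then show ?thesis by (auto simp: triangle_free_def)
    next
      case nonempty: False
      have "reducible A V k" using reducible_if_large[OF nonempty] False by simp
      then obtain F H where FH: "F \<union> H \<subseteq> V" "F \<inter> H = {}" "H \<noteq> {}"
        "3 * (card F + card H) \<le> (k + 3) * card H"
        "\<forall>h\<in>H. \<forall>x\<in>V - F. \<forall>y\<in>V - F. \<not> cyc A h x y"
        unfolding reducible_def by blast
      define W where "W = V - (F \<union> H)"
      have f: "finite F" "finite H" "finite W"
        using FH(1) fin finite_subset unfolding W_def by auto
      have "card (F \<union> H) = card F + card H" using f FH(2) by (simp add: card_Un_disjoint)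
      then have cV: "card V = card W + card F + card H"
        using FH(1) fin f unfolding W_def by (metis add.assoc card_Diff_subset card_mono finite_Un le_add_diff_inverse2)
      have "0 < card H" using FH(3) f by (simp add: card_gt_0_iff)
      then have "card W < card V" using cV by simp
      moreover have "elimination_order A W k"
        using elimination_order_subset[OF less.prems] unfolding W_def by blast
      ultimately obtain S where S: "S \<subseteq> W" "3 * card W \<le> (k + 3) * card S" "triangle_free A S"
        using less.hyps by blast
      have sub: "S \<union> H \<subseteq> V - F" using S(1) FH(1,2) unfolding W_def by blast
      have "card (S \<union> H) = card S + card H"
        using S(1) f finite_subset[OF S(1)] unfolding W_def by (intro card_Un_disjoint) auto
      then have "3 * card V \<le> (k + 3) * card (S \<union> H)"
        using S(2) FH(4) cV by (simp add: algebra_simps)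
      moreover have "triangle_free A (S \<union> H)"
        unfolding triangle_free_def
      proof (intro ballI notI)
        fix x y z assume *: "x \<in> S \<union> H" "y \<in> S \<union> H" "z \<in> S \<union> H" "cyc A x y z"
        then have "cyc A y z x" "cyc A z x y" unfolding cyc_def by auto
        then have "x \<notin> H" "y \<notin> H" "z \<notin> H" using * FH(5) sub by blast+
        then show False using * S(3) unfolding triangle_free_def by blast
      qed
      ultimately show ?thesis using sub by blast
    qed
  qed
qed

text \<open>The preceding neighbours of the last vertex of a directed cycle form a clique, so the
  cycle either contains a cyclic triangle at that vertex or can bypass it.\<close>

lemma triangle_free_imp_acyclic:
  assumes "elimination_order A S k" "triangle_free A S"
  shows "acyclic {(x, y). x \<in> S \<and> y \<in> S \<and> A x y}"
proof -
  have "finite S" using assms elimination_order.fin by blast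
  then show ?thesis using assms
  proof (induction S rule: finite_linorder_max_induct)
    case empty
    then show ?case by (simp add: acyclic_def)
  next
    case (insert m S)
    interpret elimination_order A "insert m S" k by fact
    define R where "R = {(x, y). x \<in> S \<and> y \<in> S \<and> A x y}"
    define R' where "R' = {(x, y). x \<in> insert m S \<and> y \<in> insert m S \<and> A x y}"
    have mS: "m \<notin> S" using insert.hyps by blast
    have "acyclic R"
      unfolding R_def using insert.IH elimination_order_subset[OF insert.prems(1)]
        triangle_free_mono[OF insert.prems(2)] by blast
    have bypass: "(c, d) \<in> R" if "(c, m) \<in> R'" "(m, d) \<in> R'" for c d
    proof -
      have A: "A c m" "A m d" "c \<in> S" "d \<in> S" "c \<noteq> d"
        using that irrefl asym unfolding R'_def by auto
      then have "c \<in> P m" "d \<in> P m" using insert.hyps unfolding pre_def adj_def by auto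
      then have "adj A c d" using pre_clique A(5) by blast
      moreover have "\<not> A d c"
        using insert.prems(2) A unfolding triangle_free_def cyc_def by blast
      ultimately show ?thesis using A unfolding R_def adj_def by blast
    qed
    have in_R: "(c, d) \<in> R" if "(c, d) \<in> R'" "c \<noteq> m" "d \<noteq> m" for c d
      using that unfolding R_def R'_def by blast
    \<comment> \<open>A walk off \<open>m\<close> is copied into \<open>R\<close> by bypassing each
      visit to \<open>m\<close>. While it stands at \<open>m\<close>, only its last vertex
      \<open>c\<close> before \<open>m\<close> is recorded, possibly \<open>a\<close>
      itself.\<close>
    have path: "if b = m then \<exists>c. (a, c) \<in> R\<^sup>* \<and> (c, m) \<in> R' else (a, b) \<in> R\<^sup>+"
      if "(a, b) \<in> R'\<^sup>+" "a \<noteq> m" for a b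
      using that
    proof (induction rule: trancl_induct)
      case (base b)
      then show ?case using in_R by auto
    next
      case (step b d)
      show ?case
      proof (cases "b = m")
        case True
        then obtain c where c: "(a, c) \<in> R\<^sup>*" "(c, m) \<in> R'" using step by auto
        moreover have "d \<noteq> m" using True step.hyps(2) irrefl unfolding R'_def by blast
        ultimately show ?thesis using bypass[of c d] True step.hyps(2) by (auto intro: rtrancl_into_trancl1)
      next
        case False
        then have "(a, b) \<in> R\<^sup>+" using step by auto
        then show ?thesis
          using False step.hyps(2) in_R[of b d] by (auto intro: trancl_into_rtrancl trancl_into_trancl)
      qed
    qed
    have "acyclic R'"
      unfolding acyclic_def
    proof (intro allI notI)
      fix x assume x: "(x, x) \<in> R'\<^sup>+"
      show False
      proof (cases "x = m")
        case False
        then show False using path[OF x] \<open>acyclic R\<close> unfolding acyclic_def by auto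
      next
        case True
        \<comment> \<open>A cycle through \<open>m\<close> is entered at the successor
          \<open>d\<close> of \<open>m\<close>; bypassing from the predecessor \<open>c\<close> back
          to \<open>d\<close> closes a cycle in \<open>R\<close>.\<close>
        then obtain d where d: "(m, d) \<in> R'" "(d, m) \<in> R'\<^sup>*"
          using x by (meson tranclD)
        then have "d \<noteq> m" using irrefl unfolding R'_def by blast
        then have "(d, m) \<in> R'\<^sup>+" using d(2) by (metis rtranclD)
        then obtain c where "(d, c) \<in> R\<^sup>*" "(c, m) \<in> R'" using path[of d m] \<open>d \<noteq> m\<close> by auto
        then have "(d, d) \<in> R\<^sup>+" using bypass[OF _ d(1)] by (auto intro: rtrancl_into_trancl1)
        then show False using \<open>acyclic R\<close> unfolding acyclic_def by blast
      qed
    qed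
    then show ?case unfolding R'_def .
  qed
qed

section \<open>Feedback vertex sets and bounded treewidth\<close>

lemma fvs_number_le:
  assumes "finite V" "dfvs V A F"
  shows "fvs_number V A \<le> card F"
proof -
  have "{card F | F. dfvs V A F} \<subseteq> card ` Pow V" unfolding dfvs_def by blast
  then have "finite {card F | F. dfvs V A F}" using assms(1) finite_subset by blast
  then show ?thesis unfolding fvs_number_def using assms(2) by (intro Min_le) auto
qed

text \<open>Every edge of the ambient \<open>k\<close>-tree that carries no arc is oriented along the elimination
  order, since the bypass argument needs full cliques.\<close>

lemma treewidth_elimination_order:
  assumes "oriented_graph V A" "treewidth_le k V A"
  obtains h :: "'a \<Rightarrow> nat" and B where "inj_on h V" "elimination_order B (h ` V) k"
    "\<And>x y. (x, y) \<in> A \<Longrightarrow> B (h x) (h y)"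
proof -
  obtain g :: "'a \<Rightarrow> nat" and W E where g: "inj_on g V" "g ` V \<subseteq> W" "is_ktree k W E"
    "\<forall>(u, v)\<in>A. {g u, g v} \<in> E"
    using assms(2) unfolding treewidth_le_def by blast
  obtain \<phi> where W: "finite W" "E \<subseteq> {e. e \<subseteq> W \<and> card e = 2}" and \<phi>: "bij_betw \<phi> W {1..card W}"
    and kt: "\<forall>v\<in>W. let P = {u\<in>W. {u, v} \<in> E \<and> \<phi> u < \<phi> v} in
            (\<forall>x\<in>P. \<forall>y\<in>P. x \<noteq> y \<longrightarrow> {x, y} \<in> E) \<and> card P = min k (\<phi> v - 1)"
    using g(3) unfolding is_ktree_def by blast
  have og: "finite V" "A \<subseteq> V \<times> V" "\<And>u v. (u, v) \<in> A \<Longrightarrow> (v, u) \<notin> A"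
    using assms(1) unfolding oriented_graph_def by auto
  \<comment> \<open>Vertices are renamed by their position, so that the order of \<open>nat\<close>
    is the elimination order.\<close>
  define h where "h = \<phi> \<circ> g"
  define edge where "edge x y \<longleftrightarrow> (\<exists>a\<in>V. \<exists>b\<in>V. x = h a \<and> y = h b \<and> {g a, g b} \<in> E)" for x y
  define arc where "arc x y \<longleftrightarrow> (\<exists>a b. x = h a \<and> y = h b \<and> (a, b) \<in> A)" for x y
  define B where "B x y \<longleftrightarrow> arc x y \<or> edge x y \<and> \<not> arc y x \<and> x < y" for x y
  have \<phi>_inj: "inj_on \<phi> W" using \<phi> bij_betw_imp_inj_on by blast
  have h_inj: "inj_on h V" unfolding h_def
    using g(1) \<phi>_inj g(2) by (meson comp_inj_on inj_on_subset)
  have arc_asym: "\<not> arc y x" if "arc x y" for x y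
  proof
    assume "arc y x"
    then obtain a b c d where *: "x = h a" "y = h b" "(a, b) \<in> A" "y = h c" "x = h d" "(c, d) \<in> A"
      using \<open>arc x y\<close> unfolding arc_def by blast
    then have "a = d" "b = c" using inj_onD[OF h_inj] og(2) by (metis SigmaD1 SigmaD2 subsetD)+
    then show False using * og(3) by blast
  qed
  have edge_sym: "edge y x" if xy: "edge x y" for x y
  proof -
    obtain a b where ab: "a \<in> V" "b \<in> V" "x = h a" "y = h b" "{g a, g b} \<in> E"
      using xy unfolding edge_def by blast
    moreover have "{g b, g a} \<in> E" using ab(5) by (simp add: insert_commute)
    ultimately show ?thesis unfolding edge_def by blast
  qed
  have arc_edge: "edge x y" if "arc x y" for x y
    using that g(4) og(2) unfolding arc_def edge_def by blast
  have edge_ne: "x \<noteq> y" if "edge x y" for x y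
  proof
    assume "x = y"
    then obtain a b where *: "a \<in> V" "b \<in> V" "h a = h b" "{g a, g b} \<in> E"
      using \<open>edge x y\<close> unfolding edge_def by blast
    then have "a = b" using h_inj by (meson inj_onD)
    then have "card {g a, g b} = 1" by simp
    then show False using *(4) W(2) by auto
  qed
  have adj_edge: "adj B x y \<longleftrightarrow> edge x y" for x y
    unfolding adj_def B_def using arc_edge edge_sym edge_ne by (metis linorder_neqE_nat)
  \<comment> \<open>Only tree vertices coming from \<open>V\<close> occur, hence an inclusion; the
    size bound and the clique property still carry over.\<close>
  have pre_image: "pre B (h ` V) (h v) \<subseteq> \<phi> ` {u \<in> W. {u, g v} \<in> E \<and> \<phi> u < \<phi> (g v)}"
    if v: "v \<in> V" for v
  proof
    fix x assume "x \<in> pre B (h ` V) (h v)"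
    then have x: "x < h v" "edge x (h v)" unfolding pre_def adj_edge by auto
    then obtain a b where ab: "a \<in> V" "b \<in> V" "x = h a" "h v = h b" "{g a, g b} \<in> E"
      unfolding edge_def by blast
    then have "b = v" using h_inj v by (metis inj_onD)
    then show "x \<in> \<phi> ` {u \<in> W. {u, g v} \<in> E \<and> \<phi> u < \<phi> (g v)}"
      using ab x(1) g(2) unfolding h_def by auto
  qed
  have "elimination_order B (h ` V) k"
  proof
    show "\<not> B y x" if "B x y" for x y
      using that arc_asym unfolding B_def by auto
    show "finite (h ` V)" using og(1) by simp
    fix v assume "v \<in> h ` V"
    then obtain a where a: "a \<in> V" "v = h a" by blast
    define Q where "Q = {u \<in> W. {u, g a} \<in> E \<and> \<phi> u < \<phi> (g a)}"
    have "g a \<in> W" using a g(2) by blast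
    then have Q: "\<forall>x\<in>Q. \<forall>y\<in>Q. x \<noteq> y \<longrightarrow> {x, y} \<in> E" "card Q \<le> k"
      using kt unfolding Q_def Let_def by auto
    have fQ: "finite Q" using W(1) unfolding Q_def by simp
    have sub: "pre B (h ` V) v \<subseteq> \<phi> ` Q" using pre_image[OF a(1)] unfolding Q_def a(2) .
    then have "card (pre B (h ` V) v) \<le> card (\<phi> ` Q)" using fQ by (simp add: card_mono)
    also have "\<dots> \<le> k" using card_image_le[OF fQ, of \<phi>] Q(2) by simp
    finally show "card (pre B (h ` V) v) \<le> k" .
    fix x y assume xy: "x \<in> pre B (h ` V) v" "y \<in> pre B (h ` V) v" "x \<noteq> y"
    then obtain b c where bc: "b \<in> V" "c \<in> V" "x = h b" "y = h c" unfolding pre_def by blast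
    have "u \<in> Q" if "u \<in> W" "\<phi> u \<in> \<phi> ` Q" for u
      using that inj_on_image_mem_iff[OF \<phi>_inj, of u Q] unfolding Q_def by blast
    moreover have "\<phi> (g b) \<in> \<phi> ` Q" "\<phi> (g c) \<in> \<phi> ` Q"
      using xy(1,2) sub bc(3,4) unfolding h_def by auto
    ultimately have "g b \<in> Q" "g c \<in> Q" using bc(1,2) g(2) by blast+
    moreover have "g b \<noteq> g c" using xy(3) bc unfolding h_def by auto
    ultimately have "{g b, g c} \<in> E" using Q(1) by blast
    then show "adj B x y" unfolding adj_edge edge_def using bc by blast
  qed
  moreover have "B (h x) (h y)" if "(x, y) \<in> A" for x y
    using that unfolding B_def arc_def by blast
  ultimately show thesis using that h_inj by blast
qed

theorem mainTheorem7:
  fixes k :: nat and V :: "'a set" and A :: "('a \<times> 'a) set"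
  assumes "oriented_graph V A" and "treewidth_le k V A"
  shows "real (fvs_number V A) \<le> real k / real (k + 3) * real (card V)"
proof -
  have fin: "finite V" using assms(1) unfolding oriented_graph_def by blast
  obtain h :: "'a \<Rightarrow> nat" and B where h: "inj_on h V" "elimination_order B (h ` V) k"
    "\<And>x y. (x, y) \<in> A \<Longrightarrow> B (h x) (h y)"
    using treewidth_elimination_order[OF assms] by blast
  obtain S where S: "S \<subseteq> h ` V" "3 * card (h ` V) \<le> (k + 3) * card S" "triangle_free B S"
    using large_triangle_free[OF h(2)] by blast
  define R where "R = {(x, y). x \<in> S \<and> y \<in> S \<and> B x y}"
  have "acyclic R" unfolding R_def
    using triangle_free_imp_acyclic[OF elimination_order_subset[OF h(2) S(1)] S(3)] .
  define F where "F = {v \<in> V. h v \<notin> S}"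
  \<comment> \<open>\<open>h\<close> carries walks of \<open>A\<close> outside \<open>F\<close> to
    walks of \<open>B\<close> inside \<open>S\<close>, so a directed cycle would reappear in
    \<open>R\<close>.\<close>
  have "(h x, h y) \<in> R\<^sup>+" if "(x, y) \<in> (A \<inter> ((V - F) \<times> (V - F)))\<^sup>+" for x y
    using that
  proof (induction rule: trancl_induct)
    case (base y)
    then show ?case using h(3) unfolding R_def F_def by auto
  next
    case (step y z)
    then have "(h y, h z) \<in> R" using h(3) unfolding R_def F_def by auto
    then show ?case using step.IH by (rule trancl_into_trancl[rotated])
  qed
  then have "dfvs V A F"
    using \<open>acyclic R\<close> unfolding dfvs_def acyclic_def F_def by blast
  then have le: "fvs_number V A \<le> card F" using fvs_number_le fin by blast
  have "S = h ` (V - F)" using S(1) unfolding F_def by auto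
  then have cS: "card S = card (V - F)" using h(1) by (metis Diff_subset card_image inj_on_subset)
  have "card V = card F + card (V - F)"
    using fin unfolding F_def by (metis (no_types, lifting) card_Diff_subset card_mono finite_subset le_add_diff_inverse mem_Collect_eq subsetI)
  \<comment> \<open>Substitutes \<open>|S| = |V| - |F|\<close> into
    \<open>3|V| \<le> (k + 3)|S|\<close>.\<close>
  then have "(k + 3) * card F \<le> k * card V"
    using S(2) cS card_image[OF h(1)] by (simp add: algebra_simps)
  then have "(k + 3) * fvs_number V A \<le> k * card V"
    using le by (meson le_trans mult_le_mono2)
  then have "real (k + 3) * real (fvs_number V A) \<le> real k * real (card V)"
    by (metis of_nat_le_iff of_nat_mult)
  then show ?thesis by (simp add: field_simps)
qed

end
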